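(* Let $p\in[0,1]$ and let the underlying tree be a random plane-oriented recursive tree, i.e. $\alpha=1$. Let $\mathcal{C}_n$ be the root cluster of $\mathcal{T}_n=\mathcal{T}_{1,n}$ with broadcasting induced colouring with parameter $p$, and let $\mathcal{C}$ be the limit in distribution of $|\mathcal{C}_n|/n^{(p+1)/2}$ as $n\to\infty$, i.e. the random variable whose integer moments are $\mathbb{E}[\mathcal{C}^k]=\frac{2C_k\sqrt\pi}{\Gamma((kp+k-1)/2)}$ for $k\ge1$, where $C_1=1/(p+1)$ and $(k-1)(p+1)C_k=\sum_{j=2}^kp^j\,j!\,B_{k,j}(C_1,\ldots,C_{k-j+1})$ for $k\ge2$. Then for every integer $k\ge1$ the integer moments of $\mathcal{C}$ can be written as $$\mathbb{E}[\mathcal{C}^k]=\frac{2p^{k-1}\,\Gamma(kp+k-1)\sqrt\pi}{(p+1)^{2k-1}\,\Gamma(kp)\,\Gamma((kp+(k-1))/2)}.$$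
   Context: The random plane-oriented recursive trees $(\mathcal{T}_n)_{n\ge1}=(\mathcal{T}_{1,n})_{n\ge1}$ are rooted trees grown recursively: $\mathcal{T}_1$ is a single vertex $\rho$, the root of all the trees; $\mathcal{T}_n$ is obtained from $\mathcal{T}_{n-1}$ by choosing a vertex $v$ of $\mathcal{T}_{n-1}$ at random with probability $\frac{\deg^+(v)+1}{\sum_{u\in V(\mathcal{T}_{n-1})}(\deg^+(u)+1)}$ and adding a new child to $v$, where $\deg^+(u)$ is the number of children of $u$ in $\mathcal{T}_{n-1}$. The broadcasting induced colouring of $\mathcal{T}_n$ with parameter $p$: the root is red or blue with probability $1/2$ each, and every other vertex, when added, receives the colour of its parent with probability $p$ and the other colour with probability $1-p$, independently of everything else. The root cluster $\mathcal{C}_n$ is the maximal monochromatic (connected) subtree of $\mathcal{T}_n$ containing the root, and $|\mathcal{C}_n|$ is its number of vertices. The partial Bell polynomials are $$B_{k,j}(x_1,\ldots,x_{k-j+1})=\sum_{\substack{m_1+2m_2+\cdots+(k-j+1)m_{k-j+1}=k\\ m_1+\cdots+m_{k-j+1}=j}}k!\prod_{i=1}^{k-j+1}\frac{x_i^{m_i}}{m_i!\,(i!)^{m_i}},$$ the sum being over nonnegative integers $m_i$. Convention: for $p=0$ the expressions are read as their limits as $p\to0^+$. *)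

theory Defs
  imports "HOL-Probability.Probability"
begin

text \<open>
  A rooted tree on the vertices \<open>0, \<dots>, n - 1\<close>, numbered in order of insertion (so the root is \<open>0\<close>), is
  the list of length \<open>n - 1\<close> whose entry \<open>i\<close> is the parent of the vertex \<open>i + 1\<close>. A coloured tree
  additionally has the list of the \<open>n\<close> vertex colours.
\<close>

type_synonym rtree = "nat list"
type_synonym coloured_tree = "rtree \<times> bool list"

definition vertices :: "rtree \<Rightarrow> nat set" where
  "vertices t = {..length t}"

definition child_of :: "rtree \<Rightarrow> nat \<Rightarrow> nat \<Rightarrow> bool" where
  "child_of t w v \<longleftrightarrow> (\<exists>i<length t. w = Suc i \<and> v = t ! i)"

definition out_degree :: "rtree \<Rightarrow> nat \<Rightarrow> nat" where
  "out_degree t v = card {w. child_of t w v}"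

definition port_weight :: "rtree \<Rightarrow> nat \<Rightarrow> real" where
  "port_weight t v =
     (if v \<in> vertices t
      then (real (out_degree t v) + 1) / (\<Sum>u\<in>vertices t. real (out_degree t u) + 1) else 0)"

definition choose_vertex :: "rtree \<Rightarrow> nat pmf" where
  "choose_vertex t = embed_pmf (port_weight t)"

lemma pmf_choose_vertex: "pmf (choose_vertex t) v = port_weight t v"
proof -
  let ?S = "\<Sum>u\<in>vertices t. real (out_degree t u) + 1"
  have fin: "finite (vertices t)"
    by (simp add: vertices_def)
  have pos: "?S > 0"
    by (rule sum_pos) (auto simp: vertices_def intro: add_nonneg_pos)
  have nonneg: "port_weight t x \<ge> 0" for x
    using pos by (simp add: port_weight_def)
  have "(\<integral>\<^sup>+x. ennreal (port_weight t x) \<partial>count_space UNIV)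
      = (\<Sum>x\<in>vertices t. ennreal (port_weight t x))"
    by (rule nn_integral_count_space'[OF fin]) (auto simp: port_weight_def)
  also have "\<dots> = ennreal (\<Sum>x\<in>vertices t. port_weight t x)"
    by (rule sum_ennreal) (rule nonneg)
  also have "(\<Sum>x\<in>vertices t. port_weight t x) = (\<Sum>x\<in>vertices t. (real (out_degree t x) + 1) / ?S)"
    by (rule sum.cong) (auto simp: port_weight_def)
  also have "\<dots> = 1"
    unfolding sum_divide_distrib[symmetric] using pos by (intro divide_self) simp
  finally show ?thesis
    unfolding choose_vertex_def using nonneg by (subst pmf_embed_pmf) auto
qed

definition grow :: "real \<Rightarrow> coloured_tree \<Rightarrow> coloured_tree pmf" where
  "grow p T = do {
     v \<leftarrow> choose_vertex (fst T);
     same \<leftarrow> bernoulli_pmf p;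
     return_pmf (fst T @ [v], snd T @ [if same then snd T ! v else \<not> snd T ! v])
   }"

text \<open>The law of the tree with \<open>n \<ge> 1\<close> vertices; the value at \<open>n = 0\<close> is a dummy.\<close>

fun coloured_port :: "real \<Rightarrow> nat \<Rightarrow> coloured_tree pmf" where
  "coloured_port p 0 = return_pmf ([], [True])"
| "coloured_port p (Suc 0) = map_pmf (\<lambda>b. ([], [b])) (bernoulli_pmf (1/2))"
| "coloured_port p (Suc (Suc n)) = coloured_port p (Suc n) \<bind> grow p"

definition adjacent :: "rtree \<Rightarrow> (nat \<times> nat) set" where
  "adjacent t = {(u, v). child_of t u v \<or> child_of t v u}"

definition connected_in :: "rtree \<Rightarrow> nat set \<Rightarrow> bool" where
  "connected_in t S \<longleftrightarrow> (\<forall>u\<in>S. \<forall>v\<in>S. (u, v) \<in> (adjacent t \<inter> S \<times> S)\<^sup>*)"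

definition mono_root_subtree :: "coloured_tree \<Rightarrow> nat set \<Rightarrow> bool" where
  "mono_root_subtree T S \<longleftrightarrow>
     S \<subseteq> vertices (fst T) \<and> 0 \<in> S \<and> connected_in (fst T) S \<and> (\<forall>u\<in>S. \<forall>v\<in>S. snd T ! u = snd T ! v)"

definition root_cluster :: "coloured_tree \<Rightarrow> nat set" where
  "root_cluster T = \<Union>{S. mono_root_subtree T S}"

text \<open>The union is itself a monochromatic subtree containing the root, hence the maximal one.\<close>

lemma mono_root_subtree_root_cluster: "mono_root_subtree T (root_cluster T)"
proof -
  let ?R = "root_cluster T" and ?E = "\<lambda>S. adjacent (fst T) \<inter> S \<times> S"
  have zero: "mono_root_subtree T {0}"
    by (auto simp: mono_root_subtree_def connected_in_def vertices_def)
  have path: "(u, 0) \<in> (?E ?R)\<^sup>*" "(0, u) \<in> (?E ?R)\<^sup>*" "snd T ! u = snd T ! 0" if u: "u \<in> ?R" for u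
  proof -
    from u obtain S where S: "mono_root_subtree T S" "u \<in> S"
      by (auto simp: root_cluster_def)
    then have sub: "S \<subseteq> ?R"
      unfolding root_cluster_def by (intro Union_upper) simp
    have mono: "(?E S)\<^sup>* \<subseteq> (?E ?R)\<^sup>*"
      by (rule rtrancl_mono) (intro Int_mono Sigma_mono sub subset_refl)
    have 0: "0 \<in> S" and conn: "\<forall>u\<in>S. \<forall>v\<in>S. (u, v) \<in> (?E S)\<^sup>*"
      and col: "\<forall>u\<in>S. \<forall>v\<in>S. snd T ! u = snd T ! v"
      using S(1) unfolding mono_root_subtree_def connected_in_def by - (elim conjE, assumption)+
    show "(u, 0) \<in> (?E ?R)\<^sup>*"
      by (rule subsetD[OF mono bspec[OF bspec[OF conn S(2)] 0]])
    show "(0, u) \<in> (?E ?R)\<^sup>*"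
      by (rule subsetD[OF mono bspec[OF bspec[OF conn 0] S(2)]])
    show "snd T ! u = snd T ! 0"
      by (rule bspec[OF bspec[OF col S(2)] 0])
  qed
  have "?R \<subseteq> vertices (fst T)"
    by (auto simp: root_cluster_def mono_root_subtree_def)
  moreover have "0 \<in> ?R"
    using zero by (auto simp: root_cluster_def)
  moreover have "connected_in (fst T) ?R"
    unfolding connected_in_def by (intro ballI rtrancl_trans[OF path(1) path(2)])
  moreover have "\<forall>u\<in>?R. \<forall>v\<in>?R. snd T ! u = snd T ! v"
    by (intro ballI trans[OF path(3) path(3)[symmetric]])
  ultimately show ?thesis
    unfolding mono_root_subtree_def by (intro conjI)
qed

lemma root_cluster_maximal: "mono_root_subtree T S \<Longrightarrow> S \<subseteq> root_cluster T"
  by (auto simp: root_cluster_def)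

text \<open>The law of \<open>|C\<^sub>n| / n powr ((p + 1) / 2)\<close>.\<close>

definition scaled_cluster_law :: "real \<Rightarrow> nat \<Rightarrow> real measure" where
  "scaled_cluster_law p n =
     distr (measure_pmf (coloured_port p n)) borel
       (\<lambda>T. real (card (root_cluster T)) / real n powr ((p + 1) / 2))"

definition bell_indices :: "nat \<Rightarrow> nat \<Rightarrow> (nat \<Rightarrow> nat) set" where
  "bell_indices k j =
     {m \<in> {1..k-j+1} \<rightarrow>\<^sub>E UNIV. (\<Sum>i=1..k-j+1. i * m i) = k \<and> (\<Sum>i=1..k-j+1. m i) = j}"

lemma finite_bell_indices: "finite (bell_indices k j)"
proof (rule finite_subset)
  show "bell_indices k j \<subseteq> {1..k-j+1} \<rightarrow>\<^sub>E {..j}"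
  proof
    fix m assume m: "m \<in> bell_indices k j"
    have "m i \<le> j" if i: "i \<in> {1..k-j+1}" for i
      using m member_le_sum[OF i, of m] by (auto simp: bell_indices_def)
    then show "m \<in> {1..k-j+1} \<rightarrow>\<^sub>E {..j}"
      using m by (auto simp: bell_indices_def PiE_iff)
  qed
qed (auto intro!: finite_PiE)

text \<open>The partial Bell polynomial for \<open>j \<le> k\<close>, evaluated at \<open>x 1, \<dots>, x (k - j + 1)\<close>.\<close>

definition partial_bell :: "nat \<Rightarrow> nat \<Rightarrow> (nat \<Rightarrow> real) \<Rightarrow> real" where
  "partial_bell k j x =
     (\<Sum>m\<in>bell_indices k j. fact k * (\<Prod>i=1..k-j+1. x i ^ m i / (fact (m i) * fact i ^ m i)))"

text \<open>
  \<open>y\<close> is the value of the expression \<open>F\<close> at \<open>p\<close>, where at \<open>p = 0\<close> the expression is read as its limit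
  from the right. (In HOL \<open>Gamma 0 = 0\<close>, so that evaluation at \<open>0\<close> would not be meaningful.)
\<close>

definition has_value :: "(real \<Rightarrow> real) \<Rightarrow> real \<Rightarrow> real \<Rightarrow> bool" where
  "has_value F p y \<longleftrightarrow> (if p = 0 then (F \<longlongrightarrow> y) (at_right 0) else y = F p)"

definition moment_coeffs :: "real \<Rightarrow> (nat \<Rightarrow> real) \<Rightarrow> bool" where
  "moment_coeffs p C \<longleftrightarrow>
     C 1 = 1 / (p + 1) \<and>
     (\<forall>k\<ge>2. (real k - 1) * (p + 1) * C k = (\<Sum>j=2..k. p ^ j * fact j * partial_bell k j C))"

end

theory Submission
  imports Defs "HOL-Computational_Algebra.Formal_Laurent_Series"
begin

text \<open>
  Fix \<open>q > 0\<close> and let \<open>f(z)\<close> be the exponential generating function of \<open>C\<^sub>1, C\<^sub>2, \<dots>\<close>. The partial Bell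
  polynomials are the coefficients of its powers, \<open>f ^ j / j! = (\<Sum>k. B\<^sub>k\<^sub>,\<^sub>j(C) z ^ k / k!)\<close>
  (\<open>partial_bell_eq_power_nth\<close>), so the recurrence for the \<open>C\<^sub>k\<close> is the differential equation
  \<open>(q + 1) (z f' - f) = (\<Sum>j\<ge>2. (q f) ^ j) = (q f)\<^sup>2 / (1 - q f)\<close>
  (\<open>moment_coeffs_differential_equation\<close>).

  In terms of \<open>h = - q f / (q + 1)\<close> it reads \<open>z h' (1 + (q + 1) h) = h (1 + h)\<close>. The variables separate,
  and integration gives \<open>h (1 + h) powr q = c z\<close> with \<open>c = h'(0) = - q / (q + 1)\<^sup>2\<close>
  (\<open>implicit_of_differential_equation\<close>). Thus \<open>h\<close> is the compositional inverse of an explicit series, and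
  Lagrange inversion (\<open>fps_lagrange_inversion\<close>) reads off its coefficients from those of
  \<open>(1 + z) powr (- k q)\<close>. The outcome is
  \<open>C\<^sub>k = q ^ (k - 1) (k q) (k q + 1) \<dots> (k q + k - 2) / (q + 1) ^ (2 k - 1)\<close>
  (\<open>moment_coeffs_closed_form\<close>), where the product is \<open>\<Gamma>(k q + k - 1) / \<Gamma>(k q)\<close>.

  Hence the two expressions for the \<open>k\<close>-th moment coincide for every \<open>q\<close> in \<open>(0, 1]\<close>, and they have the
  same limit at \<open>0\<close>.
\<close>

unbundle no vec_syntax

section \<open>Lagrange inversion\<close>

text \<open>\<open>F' / F ^ j\<close> has the Laurent series antiderivative \<open>- F ^ (1 - j) / (j - 1)\<close>.\<close>

lemma fls_residue_deriv_times_inverse_power: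
  fixes F :: "'a::field_char_0 fls"
  assumes "j \<ge> 2"
  shows "fls_residue (fls_deriv F * inverse F ^ j) = 0"
proof -
  obtain i where j: "j = Suc (Suc i)"
    using assms by (metis add_2_eq_Suc le_Suc_ex)
  have "fls_deriv (inverse F ^ Suc i) = of_nat (Suc i) * inverse F ^ i * fls_deriv (inverse F)"
    by (subst fls_deriv_power) (simp del: of_nat_Suc)
  also have "\<dots> = - (of_nat (Suc i) * (fls_deriv F * inverse F ^ j))"
    by (simp add: fls_inverse_deriv j power2_eq_square del: of_nat_Suc)
  finally have "of_nat (Suc i) * fls_residue (fls_deriv F * inverse F ^ j) = 0"
    using fls_residue_deriv[of "inverse F ^ Suc i"]
    by (simp add: fls_of_nat del: of_nat_Suc)
  then show ?thesis
    by (simp del: of_nat_Suc)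
qed

text \<open>
  The series \<open>\<Phi> = z / \<phi>(z)\<close> is the compositional inverse of \<open>g\<close>, so differentiating \<open>g(\<Phi>(z)) = z\<close> gives
  \<open>(\<Sum>i. (i + 1) g\<^sub>i\<^sub>+\<^sub>1 \<Phi> ^ i) \<Phi>' = 1\<close>. Divide by \<open>\<Phi> ^ k\<close> and take residues. On the left only the logarithmic
  derivative \<open>\<Phi>' / \<Phi>\<close>, which belongs to \<open>i = k - 1\<close> and has residue \<open>1\<close>, contributes; on the right,
  \<open>\<Phi> ^ (- k) = \<phi> ^ k / z ^ k\<close>.
\<close>

theorem fps_lagrange_inversion:
  fixes g \<phi> :: "'a::field_char_0 fps"
  assumes g: "g = fps_X * (\<phi> oo g)" and \<phi>0: "\<phi> $ 0 \<noteq> 0" and k: "k \<ge> 1"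
  shows "of_nat k * g $ k = (\<phi> ^ k) $ (k - 1)"
proof -
  define \<Phi> where "\<Phi> = fps_X * inverse \<phi>"
  have g0: "g $ 0 = 0"
    by (subst g) simp
  have \<Phi>0: "\<Phi> $ 0 = 0" and \<Phi>1: "\<Phi> $ 1 \<noteq> 0"
    using \<phi>0 by (simp_all add: \<Phi>_def)
  have \<phi>g0: "(\<phi> oo g) $ 0 \<noteq> 0"
    using \<phi>0 by simp
  have "\<Phi> oo g = g * inverse (\<phi> oo g)"
    using g0 \<phi>0 by (simp add: \<Phi>_def fps_compose_mult_distrib fps_inverse_compose)
  also have "\<dots> = fps_X * ((\<phi> oo g) * inverse (\<phi> oo g))"
    by (subst g) (simp add: mult.assoc)
  also have "\<dots> = fps_X"
    using \<phi>g0 by (simp add: inverse_mult_eq_1')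
  finally have right: "\<Phi> oo g = fps_X" .
  have "fps_inv \<Phi> = (fps_inv \<Phi> oo \<Phi>) oo g"
    using right by (simp add: fps_compose_assoc[OF g0 \<Phi>0, symmetric])
  then have "fps_inv \<Phi> = g"
    using g0 \<Phi>1 by (simp add: fps_inv[OF \<Phi>0])
  then have left: "g oo \<Phi> = fps_X"
    using fps_inv[OF \<Phi>0] \<Phi>1 by simp
  \<comment> \<open>Truncation keeps the sum finite: the tail is a multiple of \<open>\<Phi> ^ k\<close>, which leaves a power series after
    division by \<open>\<Phi> ^ k\<close> and hence no residue.\<close>
  let ?T = "\<Sum>i<k. fps_const (of_nat (Suc i) * g $ Suc i) * fps_X ^ i"
  define s where "s = fps_shift k (fps_deriv g)"
  have split: "fps_deriv g = ?T + fps_X ^ k * s"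
  proof (rule fps_ext)
    fix n
    have "?T $ n = (\<Sum>i<k. if n = i then of_nat (Suc i) * g $ Suc i else 0)"
      by (simp add: fps_sum_nth fps_X_power_nth if_distrib cong: if_cong del: of_nat_Suc)
    then show "fps_deriv g $ n = (?T + fps_X ^ k * s) $ n"
      by (simp add: s_def fps_X_power_mult_nth)
  qed
  have "1 = (fps_deriv g oo \<Phi>) * fps_deriv \<Phi>"
    using fps_compose_deriv[OF \<Phi>0, of g] left by simp
  also have "fps_deriv g oo \<Phi> =
      (\<Sum>i<k. fps_const (of_nat (Suc i) * g $ Suc i) * \<Phi> ^ i) + \<Phi> ^ k * (s oo \<Phi>)"
    by (subst split)
      (simp add: fps_compose_add_distrib fps_compose_sum_distrib fps_compose_mult_distrib[OF \<Phi>0]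
        fps_compose_power[OF \<Phi>0, symmetric] \<Phi>0 del: of_nat_Suc)
  finally have one: "1 = (\<Sum>i<k. fps_const (of_nat (Suc i) * g $ Suc i) * \<Phi> ^ i) * fps_deriv \<Phi>
      + \<Phi> ^ k * (s oo \<Phi>) * fps_deriv \<Phi>"
    by (simp add: algebra_simps)
  define F where "F = fps_to_fls \<Phi>"
  have F0: "F \<noteq> 0"
    using \<Phi>1 by (auto simp: F_def)
  have cancel: "F ^ i * inverse F ^ k = inverse F ^ (k - i)" if "i \<le> k" for i
  proof -
    have "inverse F ^ k = inverse F ^ i * inverse F ^ (k - i)"
      using that by (simp flip: power_add)
    moreover have "F ^ i * inverse F ^ i = 1"
      using F0 by (simp flip: power_mult_distrib)
    ultimately show ?thesis
      by (simp add: mult.assoc[symmetric])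
  qed
  have fls_sum: "fps_to_fls (\<Sum>i<n. a i) = (\<Sum>i<n. fps_to_fls (a i))" for a :: "nat \<Rightarrow> 'a fps" and n
    by (induction n) simp_all
  have "1 = (\<Sum>i<k. fls_const (of_nat (Suc i) * g $ Suc i) * F ^ i) * fls_deriv F
      + F ^ k * fps_to_fls ((s oo \<Phi>) * fps_deriv \<Phi>)"
    using arg_cong[OF one, of fps_to_fls]
    by (simp add: F_def fls_times_fps_to_fls fps_to_fls_power fls_deriv_fps_to_fls fls_sum mult.assoc)
  then have "inverse F ^ k = ((\<Sum>i<k. fls_const (of_nat (Suc i) * g $ Suc i) * F ^ i) * fls_deriv F
      + F ^ k * fps_to_fls ((s oo \<Phi>) * fps_deriv \<Phi>)) * inverse F ^ k"
    by simp
  also have "\<dots> = (\<Sum>i<k. fls_const (of_nat (Suc i) * g $ Suc i) * (fls_deriv F * (F ^ i * inverse F ^ k)))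
      + fps_to_fls ((s oo \<Phi>) * fps_deriv \<Phi>) * (F ^ k * inverse F ^ k)"
    by (simp add: algebra_simps sum_distrib_left sum_distrib_right)
  also have "\<dots> = (\<Sum>i<k. fls_const (of_nat (Suc i) * g $ Suc i) * (fls_deriv F * inverse F ^ (k - i)))
      + fps_to_fls ((s oo \<Phi>) * fps_deriv \<Phi>)"
    by (simp add: cancel)
  finally have "fls_residue (inverse F ^ k) =
      (\<Sum>i<k. of_nat (Suc i) * g $ Suc i * fls_residue (fls_deriv F * inverse F ^ (k - i)))"
    by (simp add: fls_nth_sum del: of_nat_Suc)
  also have "\<dots> = (\<Sum>i<k. if i = k - 1 then of_nat k * g $ k else 0)"
  proof (rule sum.cong)
    fix i assume i: "i \<in> {..<k}"
    have "fls_subdegree F = 1"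
    proof -
      have "subdegree \<Phi> = 1"
        using \<Phi>0 \<Phi>1 by (intro subdegreeI) auto
      then show ?thesis by (simp add: F_def fls_subdegree_fls_to_fps)
    qed
    then have "fls_residue (fls_deriv F * inverse F) = 1"
      by (simp only: fls_residue_deriv_times_inverse_eq_subdegree) simp
    then show "of_nat (Suc i) * g $ Suc i * fls_residue (fls_deriv F * inverse F ^ (k - i)) =
        (if i = k - 1 then of_nat k * g $ k else 0)"
      using i k fls_residue_deriv_times_inverse_power[of "k - i" F] by auto
  qed simp
  also have "\<dots> = of_nat k * g $ k"
    using k by simp
  finally have "of_nat k * g $ k = fls_residue (inverse F ^ k)" ..
  also have "inverse F = fls_X_inv * fps_to_fls \<phi>"
  proof (rule inverse_unique)
    have "F * (fls_X_inv * fps_to_fls \<phi>) = (fls_X * fls_X_inv) * fps_to_fls (inverse \<phi> * \<phi>)"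
      by (simp add: F_def \<Phi>_def fls_times_fps_to_fls mult_ac)
    also have "\<dots> = 1"
      using \<phi>0 by (simp add: inverse_mult_eq_1 flip: fls_inverse_X)
    finally show "F * (fls_X_inv * fps_to_fls \<phi>) = 1" .
  qed
  also have "fls_residue ((fls_X_inv * fps_to_fls \<phi>) ^ k) = (\<phi> ^ k) $ (k - 1)"
  proof -
    have "nat (int k - 1) = k - 1"
      using k by simp
    then show ?thesis
      using k by (simp add: power_mult_distrib fls_X_inv_power_times_conv_shift flip: fps_to_fls_power)
  qed
  finally show ?thesis .
qed

section \<open>Partial Bell polynomials as coefficients of powers\<close>

lemma fps_power_nth_cong:
  fixes f g :: "'a::comm_semiring_1 fps"
  assumes "\<And>i. i \<le> n \<Longrightarrow> f $ i = g $ i"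
  shows "(f ^ j) $ n = (g ^ j) $ n"
proof -
  have "i \<le> n \<Longrightarrow> (f ^ j) $ i = (g ^ j) $ i" for i
    by (induction j arbitrary: i) (auto simp: fps_mult_nth assms intro!: sum.cong)
  then show ?thesis by simp
qed

text \<open>
  Only the coefficients of \<open>f\<close> up to degree \<open>k - j + 1\<close> enter coefficient \<open>k\<close> of \<open>f ^ j\<close>, since each of the
  \<open>j\<close> factors contributes degree at least \<open>1\<close>; this is why \<open>B\<^sub>k\<^sub>,\<^sub>j\<close> has \<open>k - j + 1\<close> arguments.
\<close>

lemma fps_power_nth_shift:
  fixes f :: "'a::comm_semiring_1 fps"
  assumes "f $ 0 = 0" and "j \<le> k"
  shows "(f ^ j) $ k = (fps_shift 1 f ^ j) $ (k - j)"
proof -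
  have "f = fps_X * fps_shift 1 f"
    using assms(1) by (intro fps_ext) simp
  then have "(f ^ j) $ k = ((fps_X * fps_shift 1 f) ^ j) $ k"
    by (rule arg_cong)
  then show ?thesis
    using assms(2) by (simp add: power_mult_distrib fps_X_power_mult_nth)
qed

text \<open>
  Normalised by \<open>n!\<close>, powers satisfy a binomial and a multinomial theorem without binomial coefficients,
  and the factors \<open>m\<^sub>i!\<close> of the Bell polynomials appear in the multinomial expansion by themselves.
\<close>

definition divided_power :: "'a::field_char_0 fps \<Rightarrow> nat \<Rightarrow> 'a fps" where
  "divided_power a n = fps_const (1 / fact n) * a ^ n"

lemma divided_power_add:
  "divided_power (a + b) n = (\<Sum>l\<le>n. divided_power a l * divided_power b (n - l))"
proof -
  have "divided_power (a + b) n =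
      (\<Sum>l\<le>n. fps_const (1 / fact n) * (of_nat (n choose l) * a ^ l * b ^ (n - l)))"
    by (simp add: divided_power_def binomial_ring sum_distrib_left)
  also have "\<dots> = (\<Sum>l\<le>n. divided_power a l * divided_power b (n - l))"
  proof (rule sum.cong)
    fix l assume "l \<in> {..n}"
    then have "fps_const (1 / fact n :: 'a) * of_nat (n choose l) =
        fps_const (1 / fact l) * fps_const (1 / fact (n - l))"
      by (simp add: fps_of_nat[symmetric] binomial_fact)
    then show "fps_const (1 / fact n) * (of_nat (n choose l) * a ^ l * b ^ (n - l)) =
        divided_power a l * divided_power b (n - l)"
      by (simp add: divided_power_def algebra_simps)
  qed simp
  finally show ?thesis .
qed

definition weak_compositions :: "'i set \<Rightarrow> nat \<Rightarrow> ('i \<Rightarrow> nat) set" where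
  "weak_compositions I j = {m \<in> I \<rightarrow>\<^sub>E UNIV. (\<Sum>i\<in>I. m i) = j}"

lemma finite_weak_compositions:
  assumes "finite I"
  shows "finite (weak_compositions I j)"
proof (rule finite_subset)
  show "weak_compositions I j \<subseteq> I \<rightarrow>\<^sub>E {..j}"
  proof
    fix m assume m: "m \<in> weak_compositions I j"
    have "m i \<le> j" if i: "i \<in> I" for i
      using m member_le_sum[OF i, of m] assms by (auto simp: weak_compositions_def)
    then show "m \<in> I \<rightarrow>\<^sub>E {..j}"
      using m by (auto simp: weak_compositions_def PiE_iff)
  qed
qed (use assms in \<open>auto intro!: finite_PiE\<close>)

text \<open>The multinomial theorem, by splitting off one summand at a time.\<close>

lemma divided_power_sum:
  assumes "finite I"
  shows "divided_power (\<Sum>i\<in>I. a i) j =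
    (\<Sum>m\<in>weak_compositions I j. \<Prod>i\<in>I. divided_power (a i) (m i))"
  using assms
proof (induction I arbitrary: j rule: finite_induct)
  case empty
  then show ?case
    by (cases j) (auto simp: divided_power_def weak_compositions_def)
next
  case (insert x I)
  note fin = finite_weak_compositions[OF insert.hyps(1)]
  have "divided_power (\<Sum>i\<in>insert x I. a i) j =
      (\<Sum>l\<le>j. \<Sum>m\<in>weak_compositions I (j - l). divided_power (a x) l * (\<Prod>i\<in>I. divided_power (a i) (m i)))"
    using insert by (simp add: divided_power_add sum_distrib_left)
  also have "\<dots> = (\<Sum>(l, m)\<in>(SIGMA l:{..j}. weak_compositions I (j - l)).
      divided_power (a x) l * (\<Prod>i\<in>I. divided_power (a i) (m i)))"
    using fin by (intro sum.Sigma) auto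
  \<comment> \<open>Extensional functions take the value \<open>undefined\<close> off their domain, so removing \<open>x\<close> means resetting to it.\<close>
  also have "\<dots> = (\<Sum>m\<in>weak_compositions (insert x I) j. \<Prod>i\<in>insert x I. divided_power (a i) (m i))"
  proof (rule sum.reindex_bij_witness[of _ "\<lambda>m. (m x, m(x := undefined))" "\<lambda>(l, m). m(x := l)"])
    fix b assume b: "b \<in> (SIGMA l:{..j}. weak_compositions I (j - l))"
    then obtain l m where lm: "b = (l, m)" "l \<le> j" "m \<in> I \<rightarrow>\<^sub>E UNIV" "(\<Sum>i\<in>I. m i) = j - l"
      by (auto simp: weak_compositions_def)
    have mx: "m x = undefined"
      using lm insert.hyps by (auto simp: weak_compositions_def PiE_iff extensional_def)
    have cong: "(\<Sum>i\<in>I. (m(x := l)) i) = (\<Sum>i\<in>I. m i)"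
      using insert.hyps by (intro sum.cong) auto
    have congp: "(\<Prod>i\<in>I. divided_power (a i) ((m(x := l)) i)) = (\<Prod>i\<in>I. divided_power (a i) (m i))"
      using insert.hyps by (intro prod.cong) auto
    show "(\<lambda>m. (m x, m(x := undefined))) ((\<lambda>(l, m). m(x := l)) b) = b"
      using lm mx by (auto simp: fun_upd_idem)
    show "(\<lambda>(l, m). m(x := l)) b \<in> weak_compositions (insert x I) j"
      using lm insert.hyps cong by (auto simp: weak_compositions_def PiE_iff extensional_def)
    show "(\<Prod>i\<in>insert x I. divided_power (a i) (((\<lambda>(l, m). m(x := l)) b) i)) =
        (case b of (l, m) \<Rightarrow> divided_power (a x) l * (\<Prod>i\<in>I. divided_power (a i) (m i)))"
      using lm insert.hyps congp by simp
  next
    fix m assume m: "m \<in> weak_compositions (insert x I) j"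
    have "(\<Sum>i\<in>I. (m(x := undefined)) i) = (\<Sum>i\<in>I. m i)"
      using insert.hyps by (intro sum.cong) auto
    then show "(m x, m(x := undefined)) \<in> (SIGMA l:{..j}. weak_compositions I (j - l))"
      using m insert.hyps by (auto simp: weak_compositions_def PiE_iff extensional_def)
    show "(\<lambda>(l, m). m(x := l)) (m x, m(x := undefined)) = m"
      by simp
  qed
  finally show ?case .
qed

text \<open>
  Expanding the \<open>j\<close>-th power of \<open>(\<Sum>i. x\<^sub>i z ^ i / i!)\<close> by the multinomial theorem, the term with
  multiplicities \<open>m\<^sub>i\<close> has degree \<open>(\<Sum>i. i m\<^sub>i)\<close>, so that coefficient \<open>k\<close> collects exactly the index set of
  the Bell polynomial.
\<close>

lemma partial_bell_eq_power_nth: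
  assumes "j \<le> k"
  shows "partial_bell k j x =
    fact k / fact j * (Abs_fps (\<lambda>n. if n = 0 then 0 else x n / fact n) ^ j) $ k"
proof -
  let ?f = "Abs_fps (\<lambda>n. if n = 0 then 0 else x n / fact n)"
  let ?I = "{1..k - j + 1}"
  let ?a = "\<lambda>i. fps_const (x i / fact i) * fps_X ^ i"
  let ?c = "\<lambda>m. \<Prod>i\<in>?I. x i ^ m i / (fact (m i) * fact i ^ m i)"
  define t where "t = (\<Sum>i\<in>?I. ?a i)"
  have trunc: "t $ n = (if n \<in> ?I then x n / fact n else 0)" for n
  proof -
    have "t $ n = (\<Sum>i\<in>?I. if n = i then x i / fact i else 0)"
      unfolding t_def fps_sum_nth by (rule sum.cong) (auto simp: fps_X_power_nth)
    then show ?thesis by (simp only: sum.delta' finite_atLeastAtMost)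
  qed
  have "(?f ^ j) $ k = (fps_shift 1 ?f ^ j) $ (k - j)"
    using assms by (intro fps_power_nth_shift) simp_all
  also have "\<dots> = (fps_shift 1 t ^ j) $ (k - j)"
    by (rule fps_power_nth_cong) (simp add: trunc)
  also have "\<dots> = (t ^ j) $ k"
    using assms by (intro fps_power_nth_shift[symmetric]) (simp_all add: trunc)
  finally have "(?f ^ j) $ k / fact j = divided_power t j $ k"
    by (simp add: divided_power_def)
  also have "\<dots> = (\<Sum>m\<in>weak_compositions ?I j. (\<Prod>i\<in>?I. divided_power (?a i) (m i)) $ k)"
    unfolding t_def by (subst divided_power_sum) (simp_all only: fps_sum_nth finite_atLeastAtMost)
  also have "\<dots> = (\<Sum>m\<in>weak_compositions ?I j. if (\<Sum>i\<in>?I. i * m i) = k then ?c m else 0)"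
  proof (rule sum.cong)
    fix m
    have const_prod: "(\<Prod>i\<in>A. fps_const (g i)) = fps_const (\<Prod>i\<in>A. g i)"
      for A :: "nat set" and g :: "nat \<Rightarrow> real"
      by (induction A rule: infinite_finite_induct) simp_all
    have "(\<Prod>i\<in>?I. divided_power (?a i) (m i)) =
        (\<Prod>i\<in>?I. fps_const (x i ^ m i / (fact (m i) * fact i ^ m i)) * fps_X ^ (i * m i))"
      by (intro prod.cong)
        (auto simp: divided_power_def power_mult_distrib power_mult power_divide mult.assoc[symmetric] fps_const_power simp flip: fps_const_mult)
    also have "\<dots> = fps_const (?c m) * fps_X ^ (\<Sum>i\<in>?I. i * m i)"
      by (simp only: prod.distrib power_sum const_prod)
    finally show "(\<Prod>i\<in>?I. divided_power (?a i) (m i)) $ k =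
        (if (\<Sum>i\<in>?I. i * m i) = k then ?c m else 0)"
      by (simp add: fps_X_power_nth)
  qed simp
  also have "\<dots> = (\<Sum>m\<in>bell_indices k j. ?c m)"
  proof -
    have "{m \<in> weak_compositions ?I j. (\<Sum>i\<in>?I. i * m i) = k} = bell_indices k j"
      by (auto simp: weak_compositions_def bell_indices_def)
    then show ?thesis
      by (simp add: finite_weak_compositions flip: sum.inter_filter)
  qed
  finally have S: "(?f ^ j) $ k / fact j = (\<Sum>m\<in>bell_indices k j. ?c m)" .
  show ?thesis
    unfolding partial_bell_def sum_distrib_left[symmetric] S[symmetric] by simp
qed

section \<open>The generating function of the moment coefficients\<close>

text \<open>
  The equation is separable: for \<open>Q = h (1 + h) powr q\<close> it turns into \<open>z Q' = Q\<close>, whose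
  only power series solutions are the multiples of \<open>z\<close>. Solving \<open>Q = c z\<close> for the first factor \<open>h\<close> gives the
  form to which Lagrange inversion applies.
\<close>

lemma implicit_of_differential_equation:
  fixes h :: "'a::field_char_0 fps"
  assumes h0: "h $ 0 = 0"
    and ode: "fps_X * fps_deriv h * (1 + fps_const (q + 1) * h) = h * (1 + h)"
  shows "h = fps_X * ((fps_const (h $ 1) * fps_binomial (- q)) oo h)"
proof -
  let ?b = "fps_binomial q oo h" and ?b' = "fps_binomial (- q) oo h"
  let ?d = "fps_deriv (fps_binomial q) oo h"
  define Q where "Q = h * ?b"
  have "(1 + fps_X) * fps_deriv (fps_binomial q) = fps_const q * fps_binomial q"
    by (simp add: fps_binomial_deriv fps_divide_unit mult.left_commute inverse_mult_eq_1')
  then have "((1 + fps_X) * fps_deriv (fps_binomial q)) oo h = (fps_const q * fps_binomial q) oo h"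
    by simp
  then have d: "(1 + h) * ?d = fps_const q * ?b"
    using h0 by (simp add: fps_compose_mult_distrib fps_compose_add_distrib)
  have "(1 + h) * (fps_X * fps_deriv Q)
      = fps_X * fps_deriv h * (?b * (1 + h)) + fps_X * fps_deriv h * h * ((1 + h) * ?d)"
    using h0 by (simp add: Q_def fps_compose_deriv algebra_simps)
  also have "\<dots> = (fps_X * fps_deriv h * (1 + fps_const (q + 1) * h)) * ?b"
    unfolding d by (simp add: algebra_simps flip: fps_const_add)
  also have "\<dots> = (1 + h) * Q"
    unfolding ode by (simp add: Q_def mult_ac)
  finally have "(1 + h) * (fps_X * fps_deriv Q) = (1 + h) * Q" .
  moreover have "1 + h \<noteq> 0"
  proof
    assume "1 + h = 0"
    then have "(1 + h) $ 0 = 0" by simp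
    then show False using h0 by simp
  qed
  ultimately have Q: "fps_X * fps_deriv Q = Q"
    by simp
  have "Q = fps_const (h $ 1) * fps_X"
  proof (rule fps_ext)
    fix n
    have "of_nat n * Q $ n = Q $ n"
      using arg_cong[OF Q, of "\<lambda>f. f $ n"] by (cases n) auto
    then have "n = 1 \<or> Q $ n = 0"
      by auto
    moreover have "Q $ 1 = h $ 1"
      using h0 by (simp add: Q_def fps_mult_nth_1)
    ultimately show "Q $ n = (fps_const (h $ 1) * fps_X) $ n"
      by (cases "n = 1") auto
  qed
  moreover have "?b * ?b' = 1"
  proof -
    have "?b * ?b' = (fps_binomial q * fps_binomial (- q)) oo h"
      using h0 by (simp add: fps_compose_mult_distrib)
    also have "\<dots> = 1"
      by (simp flip: fps_binomial_add_mult)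
    finally show ?thesis .
  qed
  ultimately have "h = fps_const (h $ 1) * fps_X * ?b'"
    by (metis Q_def mult.assoc mult.right_neutral)
  also have "\<dots> = fps_X * ((fps_const (h $ 1) * fps_binomial (- q)) oo h)"
    using h0 by (simp add: fps_compose_mult_distrib mult_ac)
  finally show ?thesis .
qed

text \<open>
  The recurrence says that \<open>(q + 1) (z f' - f)\<close> and \<open>s(q f)\<close>, for \<open>s = (\<Sum>j\<ge>2. z ^ j) = z\<^sup>2 / (1 - z)\<close>, have
  the same coefficients from degree \<open>2\<close> on. Those in degrees \<open>0\<close> and \<open>1\<close> vanish on both sides: the constant
  terms because \<open>f(0) = 0\<close>, the linear ones because \<open>z f' - f\<close> kills the linear term of \<open>f\<close> and \<open>s\<close> starts in
  degree \<open>2\<close>.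
\<close>

lemma moment_coeffs_differential_equation:
  assumes C: "moment_coeffs q C"
  defines "f \<equiv> Abs_fps (\<lambda>n. if n = 0 then 0 else C n / fact n)"
  shows "fps_const (q + 1) * (fps_X * fps_deriv f - f) * (1 - fps_const q * f) = (fps_const q * f)\<^sup>2"
proof -
  define s where "s = Abs_fps (\<lambda>j. if j \<ge> 2 then 1 else (0::real))"
  let ?u = "fps_const q * f"
  have u0: "?u $ 0 = 0"
    by (simp add: f_def)
  have "fps_const (q + 1) * (fps_X * fps_deriv f - f) = s oo ?u"
  proof (rule fps_ext)
    fix n
    have u: "(s oo ?u) $ n = (\<Sum>j=2..n. q ^ j * (f ^ j) $ n)"
    proof -
      have "(s oo ?u) $ n = (\<Sum>j=0..n. if j \<ge> 2 then q ^ j * (f ^ j) $ n else 0)"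
        by (auto simp: fps_compose_nth s_def power_mult_distrib fps_const_power intro!: sum.cong)
      also have "\<dots> = (\<Sum>j=2..n. q ^ j * (f ^ j) $ n)"
        by (rule sum.mono_neutral_cong_right) auto
      finally show ?thesis .
    qed
    have l: "(fps_const (q + 1) * (fps_X * fps_deriv f - f)) $ n = (real n - 1) * (q + 1) * f $ n"
      by (cases n) (auto simp: algebra_simps)
    show "(fps_const (q + 1) * (fps_X * fps_deriv f - f)) $ n = (s oo ?u) $ n"
    proof (cases "n \<ge> 2")
      case True
      then have "(real n - 1) * (q + 1) * C n = (\<Sum>j=2..n. q ^ j * fact j * partial_bell n j C)"
        using C by (simp add: moment_coeffs_def)
      also have "\<dots> = (\<Sum>j=2..n. fact n * (q ^ j * (f ^ j) $ n))"
        by (intro sum.cong) (simp_all add: partial_bell_eq_power_nth f_def)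
      finally show ?thesis
        unfolding l u using True by (simp add: f_def sum_distrib_left[symmetric] field_simps)
    next
      case False
      then have "n = 0 \<or> n = 1" by auto
      then show ?thesis
        unfolding l u by (auto simp: f_def)
    qed
  qed
  moreover have "(s oo ?u) * (1 - ?u) = ?u\<^sup>2"
  proof -
    have "s * (1 - fps_X) = fps_X\<^sup>2"
    proof (rule fps_ext)
      fix n show "(s * (1 - fps_X)) $ n = (fps_X\<^sup>2) $ n"
        by (cases n) (auto simp: s_def algebra_simps fps_X_power_nth)
    qed
    then have "(s * (1 - fps_X)) oo ?u = fps_X\<^sup>2 oo ?u"
      by simp
    then show ?thesis
      using u0 by (simp add: fps_compose_mult_distrib fps_compose_sub_distrib fps_compose_power[symmetric])
  qed
  ultimately show ?thesis
    by simp
qed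

section \<open>The closed form\<close>

text \<open>
  The substitution \<open>h = - q f / (q + 1)\<close> puts the singularity of the separated equation at \<open>h = - 1\<close>, so that
  the ordinary binomial series applies.
\<close>

theorem moment_coeffs_closed_form:
  assumes C: "moment_coeffs q C" and q: "q > 0" and k: "k \<ge> 1"
  shows "C k = q ^ (k - 1) * pochhammer (real k * q) (k - 1) / (q + 1) ^ (2 * k - 1)"
proof -
  define f where "f = Abs_fps (\<lambda>n. if n = 0 then 0 else C n / fact n)"
  define h where "h = fps_const (- (q / (q + 1))) * f"
  let ?R = "fps_const (q + 1)" and ?Q = "fps_const q"
  have h0: "h $ 0 = 0"
    by (simp add: h_def f_def)
  have h1: "h $ 1 = - (q / (q + 1)\<^sup>2)"
    using C by (simp add: h_def f_def moment_coeffs_def power2_eq_square)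
  have Qf: "?Q * f = - (?R * h)"
    using q by (intro fps_ext) (simp add: h_def)
  then have Qf': "?Q * fps_deriv f = - (?R * fps_deriv h)"
  proof -
    have "?Q * fps_deriv f = fps_deriv (?Q * f)"
      by simp
    also have "\<dots> = - (?R * fps_deriv h)"
      unfolding Qf by simp
    finally show ?thesis .
  qed
  have ode: "?R * (fps_X * fps_deriv f - f) * (1 - ?Q * f) = (?Q * f)\<^sup>2"
    using moment_coeffs_differential_equation[OF C] by (simp add: f_def)
  have "?R * (fps_X * (?Q * fps_deriv f) - ?Q * f) * (1 - ?Q * f) = ?Q * (?Q * f)\<^sup>2"
    unfolding ode[symmetric] by (simp add: algebra_simps)
  then have "?R\<^sup>2 * ((fps_X * fps_deriv h - h) * (1 + ?R * h)) = ?R\<^sup>2 * - (?Q * h\<^sup>2)"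
    unfolding Qf Qf' by (simp add: algebra_simps power2_eq_square)
  moreover have "?R\<^sup>2 \<noteq> 0"
    using q by simp
  ultimately have "(fps_X * fps_deriv h - h) * (1 + ?R * h) = - (?Q * h\<^sup>2)"
    using mult_left_cancel by blast
  then have "fps_X * fps_deriv h * (1 + ?R * h) = h * (1 + h)"
    by (simp add: algebra_simps power2_eq_square flip: fps_const_add)
  then have "h = fps_X * ((fps_const (h $ 1) * fps_binomial (- q)) oo h)"
    using h0 by (intro implicit_of_differential_equation)
  then have "real k * h $ k = ((fps_const (h $ 1) * fps_binomial (- q)) ^ k) $ (k - 1)"
    using q k h1 by (intro fps_lagrange_inversion) auto
  also have "\<dots> = (h $ 1) ^ k * (- (real k * q) gchoose (k - 1))"
    by (simp add: power_mult_distrib fps_const_power fps_binomial_power)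
  also have "\<dots> = - ((q / (q + 1)\<^sup>2) ^ k * pochhammer (real k * q) (k - 1) / fact (k - 1))"
  proof -
    have "(- a) ^ k * (- 1) ^ (k - 1) = - (a ^ k)" for a :: real
      using k by (cases k) (simp_all add: mult.assoc flip: power_mult_distrib)
    then have "(h $ 1) ^ k * (- 1) ^ (k - 1) = - ((q / (q + 1)\<^sup>2) ^ k)"
      unfolding h1 .
    then show ?thesis
      by (simp add: gbinomial_pochhammer flip: mult.assoc)
  qed
  also have "real k * h $ k = - (q / (q + 1) * C k / fact (k - 1))"
  proof -
    have "fact k = real k * fact (k - 1)"
      using k by (simp add: fact_reduce)
    then show ?thesis
      using k by (simp add: h_def f_def)
  qed
  finally have "q / (q + 1) * C k = (q / (q + 1)\<^sup>2) ^ k * pochhammer (real k * q) (k - 1)"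
    by (simp only: neg_equal_iff_equal divide_cancel_right fact_nonzero simp_thms)
  also have "(q / (q + 1)\<^sup>2) ^ k = q / (q + 1) * (q ^ (k - 1) / (q + 1) ^ (2 * k - 1))"
  proof -
    obtain i where "k = Suc i"
      using k by (cases k) auto
    then show ?thesis
      by (simp add: power_divide power2_eq_square power_mult_distrib power_add mult_2)
  qed
  finally have "q / (q + 1) * C k =
      q / (q + 1) * (q ^ (k - 1) * pochhammer (real k * q) (k - 1) / (q + 1) ^ (2 * k - 1))"
    by (simp only: times_divide_eq_left times_divide_eq_right mult.assoc)
  moreover have "q / (q + 1) \<noteq> 0"
    using q by simp
  ultimately show ?thesis
    using mult_left_cancel by blast
qed

lemma moment_coeffs_Gamma:
  assumes "moment_coeffs q C" and q: "q > 0" and k: "k \<ge> 1"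
  shows "2 * C k * sqrt pi / Gamma ((real k * q + real k - 1) / 2) =
    2 * q ^ (k - 1) * Gamma (real k * q + real k - 1) * sqrt pi /
      ((q + 1) ^ (2 * k - 1) * Gamma (real k * q) * Gamma ((real k * q + (real k - 1)) / 2))"
proof -
  have "real k * q > 0"
    using q k by simp
  then have "real k * q \<notin> \<int>\<^sub>\<le>\<^sub>0"
    by (auto elim!: nonpos_Ints_cases)
  then have "pochhammer (real k * q) (k - 1) = Gamma (real k * q + real k - 1) / Gamma (real k * q)"
    using k by (simp add: pochhammer_Gamma of_nat_diff algebra_simps)
  then show ?thesis
    by (simp add: moment_coeffs_closed_form[OF assms] algebra_simps)
qed

theorem theorem2p11:
  fixes p :: real and C :: "real \<Rightarrow> nat \<Rightarrow> real" and M :: "'a measure" and X :: "'a \<Rightarrow> real"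
  assumes "p \<in> {0..1}"
    and "prob_space M" and "X \<in> borel_measurable M"
    and "weak_conv_m (scaled_cluster_law p) (distr M borel X)"
    and "\<And>q. q \<in> {0..1} \<Longrightarrow> moment_coeffs q (C q)"
    and "\<And>k. k \<ge> 1 \<Longrightarrow> integrable M (\<lambda>\<omega>. X \<omega> ^ k)"
    and "\<And>k. k \<ge> 1 \<Longrightarrow>
           has_value (\<lambda>q. 2 * C q k * sqrt pi / Gamma ((real k * q + real k - 1) / 2)) p
             (prob_space.expectation M (\<lambda>\<omega>. X \<omega> ^ k))"
  shows "\<forall>k\<ge>1.
           has_value (\<lambda>q. 2 * q ^ (k - 1) * Gamma (real k * q + real k - 1) * sqrt pi /
               ((q + 1) ^ (2 * k - 1) * Gamma (real k * q) * Gamma ((real k * q + (real k - 1)) / 2))) p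
             (prob_space.expectation M (\<lambda>\<omega>. X \<omega> ^ k))"
proof (intro allI impI)
  fix k :: nat
  assume k: "k \<ge> 1"
  let ?F = "\<lambda>q. 2 * C q k * sqrt pi / Gamma ((real k * q + real k - 1) / 2)"
  let ?G = "\<lambda>q. 2 * q ^ (k - 1) * Gamma (real k * q + real k - 1) * sqrt pi /
               ((q + 1) ^ (2 * k - 1) * Gamma (real k * q) * Gamma ((real k * q + (real k - 1)) / 2))"
  have eq: "?F q = ?G q" if "q \<in> {0<..1}" for q
    using that k by (intro moment_coeffs_Gamma assms(5)) auto
  \<comment> \<open>At \<open>q = 0\<close> itself the two expressions may differ, but the limit from the right does not see that value.\<close>
  have "\<forall>\<^sub>F q in at_right 0. ?F q = ?G q"
    unfolding eventually_at_right_field using eq by (intro exI[of _ 1]) auto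
  then have "(?F \<longlongrightarrow> y) (at_right 0) \<longleftrightarrow> (?G \<longlongrightarrow> y) (at_right 0)" for y
    by (rule tendsto_cong)
  then show "has_value ?G p (prob_space.expectation M (\<lambda>\<omega>. X \<omega> ^ k))"
    using assms(7)[OF k] eq[of p] assms(1) by (cases "p = 0") (auto simp: has_value_def)
qed

end
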